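(* There is a sufficiently small absolute constant $\epsilon_0>0$ such that the following holds. Let $\beta>0$ be a constant, and suppose $d\ge\Omega(\epsilon^{-2}\log n)$, $\Phi\ge1/\epsilon$, $1/n^{0.5-\beta}\le\epsilon\le\epsilon_0$, and $\delta<1/n^2$. Then for the all-nearest-neighbors problem, Alice must use a sketch of at least $\Omega(\beta\epsilon^{-2}n\log n)$ bits.
   Context: The problem is formalized in the one-way communication model with private randomness. Alice holds $n$ data points $X=\{x_1,\ldots,x_n\}\subset\{-\Phi,\ldots,\Phi\}^d$ (integer coordinates), and Bob holds $q$ query points $Y=\{y_1,\ldots,y_q\}\subset\{-\Phi,\ldots,\Phi\}^d$, where $1\le q\le n$. Distances are Euclidean. Alice, without knowing $Y$, computes a (possibly randomized) bit string called the sketch from $X$ and sends it to Bob, who must then produce the output from the sketch and $Y$. The size of the sketch is its length in bits. All-nearest-neighbors problem: for every $j\in[q]$ Bob reports an index $i_j\in[n]$ such that $\Pr\left[\forall j\in[q],\ \|y_j-x_{i_j}\|\le(1+\epsilon)\min_{i\in[n]}\|y_j-x_i\|\right]\ge 1-\delta$. *)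

theory Defs
  imports "HOL-Probability.Probability"
begin

(* Points are functions on {..<d}; the dimension is a number and not a type because the
   hidden constants of the lower bound must not depend on it. *)
type_synonym point = "nat \<Rightarrow> int"

definition grid :: "nat \<Rightarrow> nat \<Rightarrow> point set" where
  "grid d \<Phi> = {..<d} \<rightarrow>\<^sub>E {- int \<Phi>..int \<Phi>}"

(* Sets of m distinct grid points, enumerated by {..<m} so that they can be referred to by index. *)
definition point_sets :: "nat \<Rightarrow> nat \<Rightarrow> nat \<Rightarrow> (nat \<Rightarrow> point) set" where
  "point_sets m d \<Phi> = {X \<in> {..<m} \<rightarrow>\<^sub>E grid d \<Phi>. inj_on X {..<m}}"

definition eucl_dist :: "nat \<Rightarrow> point \<Rightarrow> point \<Rightarrow> real" where
  "eucl_dist d x y = L2_set (\<lambda>k. real_of_int (x k - y k)) {..<d}"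

(* Private randomness: Alice's sketch is a distribution depending on her input only, and
   Bob's answer is a distribution depending on the received sketch and his input only. *)
type_synonym alice = "(nat \<Rightarrow> point) \<Rightarrow> bool list pmf"
type_synonym bob = "bool list \<Rightarrow> (nat \<Rightarrow> point) \<Rightarrow> (nat \<Rightarrow> nat) pmf"

definition valid_answer ::
  "nat \<Rightarrow> nat \<Rightarrow> nat \<Rightarrow> real \<Rightarrow> (nat \<Rightarrow> point) \<Rightarrow> (nat \<Rightarrow> point) \<Rightarrow> (nat \<Rightarrow> nat) \<Rightarrow> bool" where
  "valid_answer n q d \<epsilon> X Y ans \<longleftrightarrow>
     (\<forall>j<q. ans j < n \<and>
        eucl_dist d (Y j) (X (ans j)) \<le> (1 + \<epsilon>) * (MIN i\<in>{..<n}. eucl_dist d (Y j) (X i)))"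

definition solves_all_nearest_neighbors ::
  "nat \<Rightarrow> nat \<Rightarrow> nat \<Rightarrow> nat \<Rightarrow> real \<Rightarrow> real \<Rightarrow> alice \<Rightarrow> bob \<Rightarrow> bool" where
  "solves_all_nearest_neighbors n q d \<Phi> \<epsilon> \<delta> A B \<longleftrightarrow>
     (\<forall>X\<in>point_sets n d \<Phi>. \<forall>Y\<in>point_sets q d \<Phi>.
        measure_pmf.prob (A X \<bind> (\<lambda>sk. B sk Y)) {ans. valid_answer n q d \<epsilon> X Y ans} \<ge> 1 - \<delta>)"

definition sketch_size_le :: "nat \<Rightarrow> nat \<Rightarrow> nat \<Rightarrow> alice \<Rightarrow> nat \<Rightarrow> bool" where
  "sketch_size_le n d \<Phi> A s \<longleftrightarrow>
     (\<forall>X\<in>point_sets n d \<Phi>. \<forall>sk\<in>set_pmf (A X). length sk \<le> s)"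

end

theory Submission
  imports Defs
begin

text \<open>
  Take random sign vectors \<open>u\<^sub>0, \<dots>, u\<^sub>n\<^sub>-\<^sub>1\<close> of dimension \<open>D = \<Theta>(\<epsilon>\<^sup>-\<^sup>2 log n)\<close>, and for a set
  \<open>S \<subseteq> [n]\<close> of odd size \<open>k = \<Theta>(\<epsilon>\<^sup>-\<^sup>2)\<close> let \<open>w\<^sub>S\<close> be the coordinatewise majority of the \<open>u\<^sub>j\<close>, \<open>j \<in> S\<close>.
  Each coordinate of \<open>w\<^sub>S\<close> has correlation \<open>\<Theta>(1 / sqrt k) = \<Theta>(\<epsilon>)\<close> with that of \<open>u\<^sub>j\<close> if \<open>j \<in> S\<close>, and 0
  otherwise. By a Chernoff bound some choice of the vectors makes \<open>\<langle>u\<^sub>j, w\<^sub>S\<rangle>\<close> reveal whether \<open>j \<in> S\<close>,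
  for all \<open>j\<close> and for half of all sets \<open>S\<close>. Half of the data points are \<open>(2 u\<^sub>i, w\<^bsub>S i\<^esub>, 0)\<close> with
  \<open>S i\<close> chosen freely among these sets, the others are points \<open>(2 u\<^sub>i, 0, p)\<close> at a fixed distance from
  every query \<open>(2 u\<^sub>i, u\<^sub>j, 0)\<close>. Which of the two points with code \<open>2 u\<^sub>i\<close> is the approximate nearest
  neighbor of this query tells whether \<open>j \<in> S i\<close>. There are at most \<open>n\<^sup>2 / 2\<close> such queries, so the union
  bound lets a single sketch determine all sets \<open>S i\<close>, which carry
  \<open>\<Omega>(n k log (n / k)) = \<Omega>(\<epsilon>\<^sup>-\<^sup>2 n log (n \<epsilon>\<^sup>2))\<close> bits, and \<open>n \<epsilon>\<^sup>2 \<ge> n\<^bsup>2\<beta>\<^esup>\<close>.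
\<close>

section \<open>A Chernoff bound in counting form\<close>

text \<open>Controls the exponential moment in the Chernoff argument. For x = -y < 0 the reason is
  that (1 + y + y^2/2) * (1 - y + y^2) is at least 1, while its first factor is at most exp
  y.\<close>

lemma exp_le_one_plus_square:
  fixes x :: real
  assumes "\<bar>x\<bar> \<le> 1"
  shows "exp x \<le> 1 + x + x\<^sup>2"
proof (cases "0 \<le> x")
  case True
  then show ?thesis using exp_bound[of x] assms by simp
next
  case False
  define y where "y = - x"
  have y: "0 \<le> y" using False by (simp add: y_def)
  have "1 + y + y\<^sup>2 / 2 \<le> exp y" using y by (rule exp_lower_Taylor_quadratic)
  moreover have "0 \<le> 1 - y + y\<^sup>2"
    using sum_squares_ge_zero[of "y - 1/2" 0] by (simp add: power2_eq_square algebra_simps)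
  ultimately have "(1 + y + y\<^sup>2 / 2) * (1 - y + y\<^sup>2) \<le> exp y * (1 - y + y\<^sup>2)"
    by (intro mult_right_mono)
  moreover have "(1 + y + y\<^sup>2 / 2) * (1 - y + y\<^sup>2) = 1 + y\<^sup>2 / 2 + y^3 / 2 + y^4 / 2"
    by (simp add: power2_eq_square power3_eq_cube power4_eq_xxxx field_simps)
  moreover have "0 \<le> y\<^sup>2 / 2 + y^3 / 2 + y^4 / 2" using y by simp
  ultimately have "1 \<le> exp y * (1 - y + y\<^sup>2)" by linarith
  then have "exp x * 1 \<le> exp x * (exp y * (1 - y + y\<^sup>2))" by (intro mult_left_mono) auto
  also have "\<dots> = 1 - y + y\<^sup>2" by (simp add: y_def exp_minus field_simps)
  finally show ?thesis by (simp add: y_def)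
qed

text \<open>Exponential moments: every counted \<open>v\<close> contributes at least 1 to a sum of
  exponentials of the shortfall, and over the product set this sum factors into \<open>D\<close>
  equal sums over \<open>\<Omega>\<close>. Counts divided by \<open>card \<Omega> ^ D\<close> are
  probabilities for \<open>D\<close> independent uniform columns.\<close>

lemma card_PiE_sum_less:
  fixes g :: "'a \<Rightarrow> real" and a \<tau> :: real
  assumes fin: "finite \<Omega>" and g: "\<And>c. c \<in> \<Omega> \<Longrightarrow> \<bar>g c\<bar> \<le> 1"
    and mean: "a * card \<Omega> \<le> (\<Sum>c\<in>\<Omega>. g c)" and \<tau>: "0 \<le> \<tau>" "\<tau> \<le> 2"
  shows "card {v \<in> {..<D} \<rightarrow>\<^sub>E \<Omega>. (\<Sum>t<D. g (v t)) < D * (a - \<tau>)}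
           \<le> card \<Omega> ^ D * exp (- (D * \<tau>\<^sup>2 / 4))"
proof -
  \<comment> \<open>This value minimizes r^2 - r * \<tau>, the exponent per coordinate, with minimum
    -\<tau>^2/4. The assumption \<tau> \<le> 2 keeps r \<le> 1, as the quadratic bound on exp
    requires.\<close>
  define r where "r = \<tau> / 2"
  have r: "0 \<le> r" "r \<le> 1" using \<tau> by (auto simp: r_def)
  let ?V = "{..<D} \<rightarrow>\<^sub>E \<Omega>"
  let ?bad = "{v \<in> ?V. (\<Sum>t<D. g (v t)) < D * (a - \<tau>)}"
  have finV: "finite ?V" using fin by (intro finite_PiE) auto
  have "(\<Sum>c\<in>\<Omega>. exp (- r * g c)) \<le> (\<Sum>c\<in>\<Omega>. 1 + r\<^sup>2 - r * g c)"
  proof (rule sum_mono)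
    fix c assume c: "c \<in> \<Omega>"
    have "r * \<bar>g c\<bar> \<le> 1 * 1" using r g[OF c] by (intro mult_mono) auto
    then have "\<bar>- r * g c\<bar> \<le> 1" using r by (simp add: abs_mult)
    from exp_le_one_plus_square[OF this]
    have "exp (- r * g c) \<le> 1 - r * g c + r\<^sup>2 * (g c)\<^sup>2" by (simp add: power_mult_distrib)
    moreover have "r\<^sup>2 * (g c)\<^sup>2 \<le> r\<^sup>2 * 1"
      using g[OF c] by (intro mult_left_mono) (auto simp: abs_square_le_1)
    ultimately show "exp (- r * g c) \<le> 1 + r\<^sup>2 - r * g c" by linarith
  qed
  also have "\<dots> = card \<Omega> * (1 + r\<^sup>2) - r * (\<Sum>c\<in>\<Omega>. g c)"
    by (simp add: sum.distrib sum_subtractf sum_distrib_left algebra_simps)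
  also have "\<dots> \<le> card \<Omega> * (1 + r\<^sup>2) - r * (a * card \<Omega>)"
    using mult_left_mono[OF mean r(1)] by simp
  also have "\<dots> = card \<Omega> * (1 + (r\<^sup>2 - r * a))" by (simp add: algebra_simps)
  also have "\<dots> \<le> card \<Omega> * exp (r\<^sup>2 - r * a)"
    by (intro mult_left_mono exp_ge_add_one_self) auto
  finally have mgf: "(\<Sum>c\<in>\<Omega>. exp (- r * g c)) \<le> card \<Omega> * exp (r\<^sup>2 - r * a)" .
  have "real (card ?bad) = (\<Sum>v\<in>?bad. 1)" by simp
  also have "\<dots> \<le> (\<Sum>v\<in>?bad. exp (r * (D * (a - \<tau>) - (\<Sum>t<D. g (v t)))))"
    using r by (intro sum_mono) auto
  also have "\<dots> \<le> (\<Sum>v\<in>?V. exp (r * (D * (a - \<tau>) - (\<Sum>t<D. g (v t)))))"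
    using finV by (intro sum_mono2) auto
  also have "\<dots> = exp (r * (D * (a - \<tau>))) * (\<Sum>v\<in>?V. \<Prod>t<D. exp (- r * g (v t)))"
    unfolding sum_distrib_left
    by (intro sum.cong refl)
      (simp add: exp_sum[symmetric] exp_add[symmetric] sum_negf sum_distrib_left[symmetric] algebra_simps)
  also have "(\<Sum>v\<in>?V. \<Prod>t<D. exp (- r * g (v t))) = (\<Sum>c\<in>\<Omega>. exp (- r * g c)) ^ D"
    using fin by (subst prod_sum_PiE[symmetric]) auto
  also have "exp (r * (D * (a - \<tau>))) * \<dots>
      \<le> exp (r * (D * (a - \<tau>))) * (card \<Omega> * exp (r\<^sup>2 - r * a)) ^ D"
    by (intro mult_left_mono power_mono mgf sum_nonneg) auto
  also have "\<dots> = card \<Omega> ^ D * (exp (r * (D * (a - \<tau>))) * exp (D * (r\<^sup>2 - r * a)))"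
    by (simp add: power_mult_distrib exp_of_nat_mult)
  also have "exp (r * (D * (a - \<tau>))) * exp (D * (r\<^sup>2 - r * a)) = exp (- (D * \<tau>\<^sup>2 / 4))"
    unfolding exp_add[symmetric] by (simp add: r_def power2_eq_square field_simps)
  finally show ?thesis by simp
qed

section \<open>Correlation of a majority with its members\<close>

text \<open>The bound \<open>2 * m choose m\<close> \<ge> 4^m / (2 sqrt m), squared to stay within
  the naturals. The induction uses the ratio 2 * (2m + 1) / (m + 1) of consecutive central binomials
  and 4 * m * (m + 1) \<le> (2m + 1)^2.\<close>

lemma central_binomial_sq_ge:
  assumes "0 < m"
  shows "16 ^ m \<le> 4 * m * (2 * m choose m)\<^sup>2"
  using assms
proof (induction m rule: nat_induct_non_zero)
  case 1
  show ?case by (simp add: numeral_2_eq_2)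
next
  case (Suc m)
  let ?b = "2 * m choose m" and ?c = "2 * Suc m choose Suc m"
  have c: "Suc m * ?c = 2 * (2 * m + 1) * ?b"
  proof -
    have "Suc m * ?c = Suc (Suc (2 * m)) * (Suc (2 * m) choose m)"
      using Suc_times_binomial[of m "Suc (2 * m)"] by simp
    moreover have "Suc m * (Suc (2 * m) choose m) = Suc (2 * m) * ?b"
      using Suc_times_binomial_add[of m m] binomial_symmetric[of m "Suc (2*m)"]
        Suc_times_binomial[of m "2 * m"]
      by (metis (no_types, lifting) Suc_diff_le diff_add_inverse le_add1 mult_2 le_SucI)
    ultimately show ?thesis by (simp add: algebra_simps)
  qed
  have "Suc m * 16 ^ Suc m = 16 * Suc m * 16 ^ m" by (simp add: algebra_simps)
  also have "\<dots> \<le> 16 * Suc m * (4 * m * ?b\<^sup>2)" using Suc.IH by (intro mult_left_mono) auto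
  also have "\<dots> \<le> 16 * (2 * m + 1)\<^sup>2 * ?b\<^sup>2"
    by (simp add: power2_eq_square algebra_simps)
  also have "\<dots> = 4 * (Suc m * ?c)\<^sup>2" unfolding c by (simp add: power2_eq_square algebra_simps)
  also have "\<dots> = Suc m * (4 * Suc m * ?c\<^sup>2)" by (simp only: power2_eq_square mult_ac)
  finally show ?case by (simp only: Suc_mult_le_cancel1)
qed

text \<open>A column of the sign matrix is encoded by the set of its positive entries.\<close>

definition sg :: "nat \<Rightarrow> nat set \<Rightarrow> int" where
  "sg l P = (if l \<in> P then 1 else - 1)"

text \<open>Meant for sets \<open>S\<close> of size 2m + 1, where more than \<open>m\<close>
  positive entries form a strict majority and ties cannot occur.\<close>

definition maj :: "nat \<Rightarrow> nat set \<Rightarrow> nat set \<Rightarrow> int" where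
  "maj m S P = (if m < card (S \<inter> P) then 1 else - 1)"

lemma sg_square [simp]: "sg l P * sg l P = 1" and abs_sg [simp]: "\<bar>sg l P\<bar> = 1"
  by (auto simp: sg_def)

lemma abs_maj [simp]: "\<bar>maj m S P\<bar> = 1"
  by (simp add: maj_def)

text \<open>Pairing each column without \<open>j\<close> with the one that contains \<open>j\<close>
  leaves the discrete derivative of \<open>h\<close> in direction \<open>j\<close>. It vanishes when
  \<open>h\<close> ignores \<open>j\<close>, which gives both orthogonality lemmas below.\<close>

lemma sum_Pow_sg:
  fixes h :: "nat set \<Rightarrow> int"
  assumes "finite U" "j \<in> U"
  shows "(\<Sum>P\<in>Pow U. sg j P * h P) = (\<Sum>P\<in>Pow (U - {j}). h (insert j P) - h P)"
proof -
  let ?W = "U - {j}"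
  have "Pow U = Pow ?W \<union> insert j ` Pow ?W"
    using assms(2) Pow_insert[of j ?W] by (simp add: insert_absorb)
  moreover have "Pow ?W \<inter> insert j ` Pow ?W = {}" by auto
  moreover have "inj_on (insert j) (Pow ?W)" by (auto simp: inj_on_def)
  ultimately have "(\<Sum>P\<in>Pow U. sg j P * h P)
      = (\<Sum>P\<in>Pow ?W. sg j P * h P) + (\<Sum>P\<in>Pow ?W. sg j (insert j P) * h (insert j P))"
    using assms(1) by (simp add: sum.union_disjoint sum.reindex)
  also have "(\<Sum>P\<in>Pow ?W. sg j P * h P) = (\<Sum>P\<in>Pow ?W. - h P)"
    by (intro sum.cong) (auto simp: sg_def)
  finally show ?thesis by (simp add: sg_def sum_subtractf sum_negf)
qed

lemma sum_Pow_sg_sg: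
  assumes "finite U" "i \<in> U" "i \<noteq> l"
  shows "(\<Sum>P\<in>Pow U. sg i P * sg l P) = 0"
  using assms by (subst sum_Pow_sg) (auto simp: sg_def)

lemma sum_Pow_sg_maj_notin:
  assumes "finite U" "j \<in> U" "j \<notin> S"
  shows "(\<Sum>P\<in>Pow U. sg j P * maj m S P) = 0"
  using assms by (subst sum_Pow_sg) (auto simp: maj_def)

text \<open>Entry \<open>j\<close> decides the majority exactly when the other 2m members split
  evenly, and each such column contributes 2. The mean correlation is thus
  (\<open>2 * m choose m\<close>) / 4^m; multiplying by 4^m keeps the identity in the
  integers.\<close>

lemma sum_Pow_sg_maj_in:
  assumes U: "finite U" and S: "S \<subseteq> U" "card S = 2 * m + 1" and j: "j \<in> S"
  shows "4 ^ m * (\<Sum>P\<in>Pow U. sg j P * maj m S P) = int ((2 * m choose m) * card (Pow U))"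
proof -
  let ?W = "U - {j}" and ?T = "S - {j}"
  have finS: "finite S" using U S finite_subset by auto
  have cT: "card ?T = 2 * m" using S j finS by simp
  have cU: "card U = card (U - S) + (2 * m + 1)"
    using S U finS by (metis card_Diff_subset card_mono le_add_diff_inverse2)
  have eq: "maj m S (insert j P) - maj m S P = (if card (?T \<inter> P) = m then 2 else 0)"
    if "P \<in> Pow ?W" for P
  proof -
    have "S \<inter> insert j P = insert j (?T \<inter> P)" "S \<inter> P = ?T \<inter> P" using that j by auto
    moreover have "finite (?T \<inter> P)" using finS by auto
    ultimately show ?thesis by (simp add: maj_def)
  qed
  \<comment> \<open>A column is split into its trace on the other members of \<open>S\<close> and
    its part outside \<open>S\<close>; the evenly split traces are then counted by the central
    binomial.\<close>
  have bij: "bij_betw (\<lambda>P. (?T \<inter> P, P - S)) {P \<in> Pow ?W. card (?T \<inter> P) = m}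
      ({R. R \<subseteq> ?T \<and> card R = m} \<times> Pow (U - S))"
  proof (rule bij_betw_byWitness[where f' = "\<lambda>(R, R'). R \<union> R'"])
    have *: "?T \<inter> (R \<union> R') = R" if "R \<subseteq> ?T" "R' \<subseteq> U - S" for R R' using that by auto
    show "(\<lambda>(R, R'). R \<union> R') ` ({R. R \<subseteq> ?T \<and> card R = m} \<times> Pow (U - S))
       \<subseteq> {P \<in> Pow ?W. card (?T \<inter> P) = m}"
      using S j by (auto simp: * )
  qed (use S j in auto)
  have "card {P \<in> Pow ?W. card (?T \<inter> P) = m} = (2 * m choose m) * 2 ^ card (U - S)"
    using bij_betw_same_card[OF bij] n_subsets[of ?T m] finS cT U
    by (simp add: card_cartesian_product card_Pow)
  moreover have "(\<Sum>P\<in>Pow U. sg j P * maj m S P)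
      = (\<Sum>P\<in>Pow ?W. if card (?T \<inter> P) = m then 2 else 0)"
    using U S j by (subst sum_Pow_sg) (auto intro!: sum.cong simp: eq)
  moreover have "\<dots> = 2 * int (card {P \<in> Pow ?W. card (?T \<inter> P) = m})"
    using U by (subst sum.inter_filter[symmetric]) auto
  ultimately show ?thesis
    using U by (simp add: card_Pow cU power_add power_mult)
qed

section \<open>The sign matrix by the probabilistic method\<close>

text \<open>First moment argument over all \<open>D\<close>-tuples of columns. Two distinct rows are
  too correlated with probability at most \<open>e\<close>, which costs n^2 * e over all pairs. A
  set \<open>S\<close> is misread at some \<open>j\<close> with probability at most n * e, so by
  Markov more than half of the sets are misread with probability at most 2n * e. Giving up half of
  the sets avoids a union bound over all of them, which would need a far larger
  \<open>D\<close>.\<close>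

lemma exists_separating_sign_matrix:
  fixes \<epsilon> :: real and n m D :: nat
  assumes k: "2 * m + 1 \<le> n" and \<epsilon>: "0 < \<epsilon>" "\<epsilon> \<le> 1 / 2"
    and bias: "16 * \<epsilon> * 4 ^ m \<le> (2 * m choose m)"
    and small: "((real n)\<^sup>2 + 2 * real n) * exp (- (4 * D * \<epsilon>\<^sup>2)) < 1"
  obtains v G where
    "\<And>i l. i < n \<Longrightarrow> l < n \<Longrightarrow> i \<noteq> l \<Longrightarrow> (\<Sum>t<D. sg i (v t) * sg l (v t)) \<le> 4 * \<epsilon> * D"
    "\<And>S. S \<in> G \<Longrightarrow> S \<subseteq> {..<n} \<and> card S = 2 * m + 1"
    "(n choose (2 * m + 1)) \<le> 2 * card G"
    "\<And>S j. S \<in> G \<Longrightarrow> j \<in> S \<Longrightarrow> 12 * \<epsilon> * D \<le> (\<Sum>t<D. sg j (v t) * maj m S (v t))"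
    "\<And>S j. S \<in> G \<Longrightarrow> j < n \<Longrightarrow> j \<notin> S \<Longrightarrow> (\<Sum>t<D. sg j (v t) * maj m S (v t)) \<le> 4 * \<epsilon> * D"
proof -
  let ?\<Omega> = "Pow {..<n}"
  define V where "V = ({..<D} \<rightarrow>\<^sub>E ?\<Omega>)"
  define K where "K = {S. S \<subseteq> {..<n} \<and> card S = 2 * m + 1}"
  define e where "e = exp (- (4 * D * \<epsilon>\<^sup>2))"
  define pbad where "pbad i l = {v \<in> V. 4 * \<epsilon> * D < (\<Sum>t<D. sg i (v t) * sg l (v t))}" for i l
  define sbad where "sbad S j = {v \<in> V. if j \<in> S
      then (\<Sum>t<D. sg j (v t) * maj m S (v t)) < 12 * \<epsilon> * D
      else 4 * \<epsilon> * D < (\<Sum>t<D. sg j (v t) * maj m S (v t))}" for S j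
  have finV: "finite V" unfolding V_def by (intro finite_PiE) auto
  have finK: "finite K" unfolding K_def by simp
  have cardV: "card V = card ?\<Omega> ^ D" unfolding V_def by (subst card_PiE) auto
  have cardK: "card K = n choose (2 * m + 1)" unfolding K_def using n_subsets[of "{..<n}"] by simp
  \<comment> \<open>Deviation 4\<epsilon> per coordinate turns the means 16\<epsilon> (members) and
    0 (nonmembers, pairs of rows) into the thresholds 12\<epsilon> and 4\<epsilon>. Upper tails are
    obtained by negating \<open>g\<close>.\<close>
  have tail: "real (card {v \<in> V. (\<Sum>t<D. g (v t)) < D * (a - 4 * \<epsilon>)}) \<le> card V * e"
    if "\<And>c. \<bar>g c\<bar> \<le> (1::real)" "a * card ?\<Omega> \<le> (\<Sum>c\<in>?\<Omega>. g c)" for g and a :: real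
    using card_PiE_sum_less[of ?\<Omega> g a "4 * \<epsilon>" D] that \<epsilon>
    unfolding V_def[symmetric] cardV e_def by (simp add: power_mult_distrib algebra_simps)
  have pbad: "card (pbad i l) \<le> card V * e" if "i < n" "i \<noteq> l" for i l
  proof -
    have "pbad i l = {v \<in> V. (\<Sum>t<D. - real_of_int (sg i (v t) * sg l (v t))) < D * (0 - 4 * \<epsilon>)}"
      unfolding pbad_def by (auto simp: sum_negf algebra_simps)
    moreover have "(\<Sum>c\<in>?\<Omega>. real_of_int (sg i c * sg l c)) = 0"
      using that by (subst of_int_sum[symmetric]) (simp add: sum_Pow_sg_sg)
    ultimately show ?thesis
      using tail[of "\<lambda>c. - real_of_int (sg i c * sg l c)" 0]
      by (simp add: sum_negf abs_mult flip: of_int_abs)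
  qed
  have sbad: "card (sbad S j) \<le> card V * e" if S: "S \<in> K" and j: "j < n" for S j
  proof (cases "j \<in> S")
    case True
    have "sbad S j = {v \<in> V. (\<Sum>t<D. real_of_int (sg j (v t) * maj m S (v t))) < D * (16 * \<epsilon> - 4 * \<epsilon>)}"
      using True unfolding sbad_def by (auto simp: algebra_simps)
    moreover have "16 * \<epsilon> * card ?\<Omega> \<le> (\<Sum>c\<in>?\<Omega>. real_of_int (sg j c * maj m S c))"
    proof -
      have "4 ^ m * (\<Sum>P\<in>?\<Omega>. sg j P * maj m S P) = int ((2 * m choose m) * card ?\<Omega>)"
        using S True unfolding K_def by (intro sum_Pow_sg_maj_in) auto
      then have "4 ^ m * (\<Sum>c\<in>?\<Omega>. real_of_int (sg j c * maj m S c)) = (2 * m choose m) * card ?\<Omega>"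
        by (metis (mono_tags, lifting) of_int_mult of_int_of_nat_eq of_int_power of_int_numeral of_int_sum sum.cong)
      moreover have "16 * \<epsilon> * 4 ^ m * card ?\<Omega> \<le> (2 * m choose m) * real (card ?\<Omega>)"
        using bias by (intro mult_right_mono) auto
      ultimately have "4 ^ m * (16 * \<epsilon> * card ?\<Omega>) \<le> 4 ^ m * (\<Sum>c\<in>?\<Omega>. real_of_int (sg j c * maj m S c))"
        by (simp add: mult_ac)
      then show ?thesis by (subst (asm) mult_le_cancel_left_pos) auto
    qed
    ultimately show ?thesis
      using tail[of "\<lambda>c. real_of_int (sg j c * maj m S c)" "16 * \<epsilon>"]
      by (simp add: abs_mult flip: of_int_abs)
  next
    case False
    have "sbad S j = {v \<in> V. (\<Sum>t<D. - real_of_int (sg j (v t) * maj m S (v t))) < D * (0 - 4 * \<epsilon>)}"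
      using False unfolding sbad_def by (auto simp: sum_negf algebra_simps)
    moreover have "(\<Sum>c\<in>?\<Omega>. real_of_int (sg j c * maj m S c)) = 0"
      using j False by (subst of_int_sum[symmetric]) (simp add: sum_Pow_sg_maj_notin)
    ultimately show ?thesis
      using tail[of "\<lambda>c. - real_of_int (sg j c * maj m S c)" 0]
      by (simp add: sum_negf abs_mult flip: of_int_abs)
  qed
  define P where "P = (\<Union>(i, l)\<in>{(i, l). i < n \<and> l < n \<and> i \<noteq> l}. pbad i l)"
  define bad where "bad v = {S \<in> K. \<exists>j<n. v \<in> sbad S j}" for v
  define R where "R = {v \<in> V. card K < 2 * card (bad v)}"
  have cP: "card P \<le> n\<^sup>2 * (card V * e)"
  proof -
    let ?I = "{(i, l). i < n \<and> l < n \<and> i \<noteq> l}"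
    have sub: "?I \<subseteq> {..<n} \<times> {..<n}" by auto
    then have fin: "finite ?I" by (rule finite_subset) auto
    have "card ?I \<le> n\<^sup>2" using card_mono[OF _ sub] by (simp add: power2_eq_square)
    have "real (card P) \<le> real (\<Sum>p\<in>?I. card (case p of (i, l) \<Rightarrow> pbad i l))"
      unfolding P_def using fin by (intro of_nat_mono card_UN_le)
    also have "\<dots> = (\<Sum>(i, l)\<in>?I. real (card (pbad i l)))" by (simp add: case_prod_beta)
    also have "\<dots> \<le> (\<Sum>p\<in>?I. card V * e)" by (intro sum_mono) (auto intro: pbad)
    also have "\<dots> = real (card ?I) * (card V * e)" by simp
    also have "\<dots> \<le> real (n\<^sup>2) * (card V * e)"
      using \<open>card ?I \<le> n\<^sup>2\<close> by (intro mult_right_mono of_nat_mono) (auto simp: e_def)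
    finally show ?thesis .
  qed
  \<comment> \<open>Markov's inequality; the pairs of a matrix and a misread set are then counted by
    sets instead of matrices.\<close>
  have "card R * card K \<le> 2 * (\<Sum>v\<in>V. card (bad v))"
  proof -
    have "card R * card K = (\<Sum>v\<in>R. card K)" by simp
    also have "\<dots> \<le> (\<Sum>v\<in>R. 2 * card (bad v))" by (intro sum_mono) (auto simp: R_def)
    also have "\<dots> \<le> (\<Sum>v\<in>V. 2 * card (bad v))" using finV by (intro sum_mono2) (auto simp: R_def)
    finally show ?thesis by (simp add: sum_distrib_left)
  qed
  also have "(\<Sum>v\<in>V. card (bad v)) = (\<Sum>S\<in>K. card {v \<in> V. \<exists>j<n. v \<in> sbad S j})"
    using sum_multicount_gen[OF finV finK, of "\<lambda>v S. \<exists>j<n. v \<in> sbad S j"] by (auto simp: bad_def)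
  finally have "real (card R * card K) \<le> real (2 * (\<Sum>S\<in>K. card {v \<in> V. \<exists>j<n. v \<in> sbad S j}))"
    unfolding of_nat_le_iff .
  also have "\<dots> \<le> 2 * (\<Sum>S\<in>K. n * (card V * e))"
  proof -
    have "real (card {v \<in> V. \<exists>j<n. v \<in> sbad S j}) \<le> n * (card V * e)" if S: "S \<in> K" for S
    proof -
      have "{v \<in> V. \<exists>j<n. v \<in> sbad S j} = (\<Union>j\<in>{..<n}. sbad S j)" by (auto simp: sbad_def)
      then have "real (card {v \<in> V. \<exists>j<n. v \<in> sbad S j}) \<le> real (\<Sum>j<n. card (sbad S j))"
        using card_UN_le[of "{..<n}" "sbad S"] by (simp only: of_nat_le_iff finite_lessThan)
      also have "\<dots> \<le> (\<Sum>j<n. card V * e)"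
        unfolding of_nat_sum using sbad[OF S] by (intro sum_mono) auto
      finally show ?thesis by simp
    qed
    then have "(\<Sum>S\<in>K. real (card {v \<in> V. \<exists>j<n. v \<in> sbad S j})) \<le> (\<Sum>S\<in>K. n * (card V * e))"
      by (intro sum_mono)
    then show ?thesis by simp
  qed
  finally have "card K * real (card R) \<le> card K * (2 * n * (card V * e))"
    by (simp add: algebra_simps)
  moreover have "0 < card K" using k by (simp add: cardK)
  ultimately have cR: "card R \<le> 2 * n * (card V * e)" by simp
  have "V \<noteq> {}" unfolding V_def by (auto simp: PiE_eq_empty_iff)
  then have V0: "0 < card V" using finV by (simp add: card_gt_0_iff)
  have "real (card (P \<union> R)) \<le> real (card P) + real (card R)"
    by (simp add: card_Un_le flip: of_nat_add)
  also have "\<dots> \<le> card V * (((real n)\<^sup>2 + 2 * real n) * e)"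
    using cP cR by (simp add: algebra_simps)
  also have "\<dots> < real (card V) * 1"
    using small V0 unfolding e_def by (intro mult_strict_left_mono) auto
  finally have "card (P \<union> R) < card V" by simp
  moreover have "finite (P \<union> R)"
    by (rule finite_subset[OF _ finV]) (auto simp: P_def pbad_def R_def)
  ultimately obtain v where v: "v \<in> V" "v \<notin> P" "v \<notin> R"
    by (metis Un_iff card_mono leD subsetI)
  show thesis
  proof (rule that[of v "K - bad v"])
    show "(\<Sum>t<D. sg i (v t) * sg l (v t)) \<le> 4 * \<epsilon> * D" if "i < n" "l < n" "i \<noteq> l" for i l
      using v that unfolding P_def pbad_def by force
    have "card (bad v) \<le> card K" "card (K - bad v) = card K - card (bad v)"
      using finK by (auto simp: bad_def intro!: card_mono card_Diff_subset)
    then show "(n choose (2 * m + 1)) \<le> 2 * card (K - bad v)"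
      using v unfolding R_def cardK[symmetric] by auto
    show "S \<subseteq> {..<n} \<and> card S = 2 * m + 1" if "S \<in> K - bad v" for S
      using that by (auto simp: K_def)
    fix S j assume S: "S \<in> K - bad v"
    show "12 * \<epsilon> * D \<le> (\<Sum>t<D. sg j (v t) * maj m S (v t))" if "j \<in> S"
    proof -
      have "j < n" using S that by (auto simp: K_def)
      then have "v \<notin> sbad S j" using S by (auto simp: bad_def)
      then show ?thesis using v(1) that by (auto simp: sbad_def)
    qed
    show "(\<Sum>t<D. sg j (v t) * maj m S (v t)) \<le> 4 * \<epsilon> * D" if "j < n" "j \<notin> S"
    proof -
      have "v \<notin> sbad S j" using S that by (auto simp: bad_def)
      then show ?thesis using v(1) that by (auto simp: sbad_def)
    qed
  qed
qed

section \<open>From correct sketches to a counting bound\<close>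

text \<open>The sum of the error probabilities over all queries is below 1/2, so some sketch answers
  every single query correctly with probability above 1/2. Two inputs whose correct answers
  to some query exclude each other cannot share this sketch.\<close>

lemma card_le_card_sketches:
  fixes A :: "'x \<Rightarrow> 'k pmf" and B :: "'k \<Rightarrow> 'y \<Rightarrow> 'a pmf" and \<delta> :: real
  assumes finQ: "finite Q" and \<delta>: "card Q * \<delta> < 1 / 2"
    and correct: "\<And>x y. x \<in> F \<Longrightarrow> y \<in> Q \<Longrightarrow>
      1 - \<delta> \<le> measure_pmf.prob (A x \<bind> (\<lambda>k. B k y)) (W x y)"
    and finK: "finite K" and K: "\<And>x. x \<in> F \<Longrightarrow> set_pmf (A x) \<subseteq> K"
    and sep: "\<And>x x'. x \<in> F \<Longrightarrow> x' \<in> F \<Longrightarrow> x \<noteq> x' \<Longrightarrow> \<exists>y\<in>Q. W x y \<inter> W x' y = {}"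
  shows "card F \<le> card K"
proof -
  have "\<exists>k\<in>K. \<forall>y\<in>Q. measure_pmf.prob (B k y) (W x y) > 1 / 2" if x: "x \<in> F" for x
  proof (rule ccontr)
    assume contra: "\<not> ?thesis"
    let ?err = "\<lambda>k y. measure_pmf.prob (B k y) (- W x y)"
    have int: "integrable (A x) (\<lambda>k. ?err k y)" for y
      by (rule measure_pmf.integrable_const_bound[where B = 1]) auto
    have err: "measure_pmf.expectation (A x) (\<lambda>k. ?err k y) \<le> \<delta>" if y: "y \<in> Q" for y
    proof -
      have "measure_pmf.prob (A x \<bind> (\<lambda>k. B k y)) (- W x y)
          = measure_pmf.expectation (A x) (\<lambda>k. ?err k y)"
        unfolding measure_def emeasure_bind_pmf
        by (simp add: integral_eq_nn_integral measure_pmf.emeasure_eq_measure)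
      then show ?thesis
        using correct[OF x y] measure_pmf.prob_compl[of "W x y" "A x \<bind> (\<lambda>k. B k y)"]
        by (simp add: Compl_eq_Diff_UNIV)
    qed
    \<comment> \<open>If every sketch failed some query with probability at least 1/2, its total
      error would be at least 1/2, whereas linearity bounds the mean total error by
      \<open>card Q * \<delta>\<close>.\<close>
    have "1 / 2 = measure_pmf.expectation (A x) (\<lambda>k. 1 / 2 :: real)" by simp
    also have "\<dots> \<le> measure_pmf.expectation (A x) (\<lambda>k. \<Sum>y\<in>Q. ?err k y)"
    proof (rule integral_mono_AE)
      show "AE k in measure_pmf (A x). 1 / 2 \<le> (\<Sum>y\<in>Q. ?err k y)"
      proof (rule AE_pmfI)
        fix k assume "k \<in> set_pmf (A x)"
        then obtain y where y: "y \<in> Q" "\<not> measure_pmf.prob (B k y) (W x y) > 1 / 2"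
          using contra K[OF x] by blast
        then have "1 / 2 \<le> ?err k y"
          using measure_pmf.prob_compl[of "W x y" "B k y"] by (simp add: Compl_eq_Diff_UNIV)
        also have "\<dots> \<le> (\<Sum>y\<in>Q. ?err k y)" using finQ y by (intro member_le_sum) auto
        finally show "1 / 2 \<le> (\<Sum>y\<in>Q. ?err k y)" .
      qed
    qed (auto intro: int)
    also have "\<dots> = (\<Sum>y\<in>Q. measure_pmf.expectation (A x) (\<lambda>k. ?err k y))"
      using int by (simp add: integral_sum)
    also have "\<dots> \<le> (\<Sum>y\<in>Q. \<delta>)" using err by (intro sum_mono)
    finally show False using \<delta> by simp
  qed
  then obtain h where h: "\<And>x. x \<in> F \<Longrightarrow> h x \<in> K"
    "\<And>x y. x \<in> F \<Longrightarrow> y \<in> Q \<Longrightarrow> measure_pmf.prob (B (h x) y) (W x y) > 1 / 2"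
    by metis
  have "inj_on h F"
  proof (rule inj_onI, rule ccontr)
    fix x x' assume x: "x \<in> F" "x' \<in> F" "h x = h x'" "x \<noteq> x'"
    then obtain y where y: "y \<in> Q" "W x y \<inter> W x' y = {}" using sep by blast
    have "measure_pmf.prob (B (h x) y) (W x y \<union> W x' y)
        = measure_pmf.prob (B (h x) y) (W x y) + measure_pmf.prob (B (h x) y) (W x' y)"
      using y by (intro measure_pmf.finite_measure_Union) auto
    moreover have "\<dots> > 1" using h(2)[OF x(1) y(1)] h(2)[OF x(2) y(1)] x(3) by simp
    ultimately show False using measure_pmf.prob_le_1[of "B (h x) y" "W x y \<union> W x' y"] by linarith
  qed
  then show ?thesis using h(1) finK by (intro card_inj_on_le) auto
qed

lemma card_bool_lists_le: "card {sk :: bool list. length sk \<le> s} \<le> 2 ^ (s + 1)"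
proof -
  have "card {sk :: bool list. set sk \<subseteq> UNIV \<and> length sk \<le> s} = (\<Sum>i\<le>s. 2 ^ i)"
    by (subst card_lists_length_le) auto
  also have "\<dots> \<le> 2 ^ (s + 1)" by (induction s) auto
  finally show ?thesis by simp
qed

section \<open>Block points and squared distances\<close>

text \<open>Block \<open>a\<close> holds the code of an index, \<open>b\<close> a row or a majority
  vector, and \<open>p\<close> the padding that tunes a distance. The remaining coordinates are 0,
  so surplus dimensions do not affect distances.\<close>

definition block_point :: "nat \<Rightarrow> nat \<Rightarrow> (nat \<Rightarrow> int) \<Rightarrow> (nat \<Rightarrow> int) \<Rightarrow> (nat \<Rightarrow> int) \<Rightarrow> point" where
  "block_point d D a b p = (\<lambda>t\<in>{..<d}. if t < D then a t else if t < 2 * D then b (t - D)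
     else if t < 3 * D then p (t - 2 * D) else 0)"

lemma block_point_in_grid:
  assumes "\<And>t. \<bar>a t\<bar> \<le> int \<Phi>" "\<And>t. \<bar>b t\<bar> \<le> int \<Phi>" "\<And>t. \<bar>p t\<bar> \<le> int \<Phi>"
  shows "block_point d D a b p \<in> grid d \<Phi>"
  unfolding block_point_def grid_def using assms by (auto simp: abs_le_iff minus_le_iff)

lemma eucl_dist_block_point_square:
  assumes "3 * D \<le> d"
  shows "(eucl_dist d (block_point d D a b p) (block_point d D a' b' p'))\<^sup>2
    = (\<Sum>t<D. (a t - a' t)\<^sup>2) + (\<Sum>t<D. (b t - b' t)\<^sup>2) + (\<Sum>t<D. (p t - p' t)\<^sup>2)"
proof -
  let ?x = "block_point d D a b p" and ?y = "block_point d D a' b' p'"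
  let ?g = "\<lambda>t. (?x t - ?y t)\<^sup>2"
  have shift: "(\<Sum>t\<in>{m..<m + D}. ?g t) = (\<Sum>t<D. ?g (t + m))" for m
    using sum.shift_bounds_nat_ivl[of ?g 0 m D] by (simp add: add.commute lessThan_atLeast0)
  have "(eucl_dist d ?x ?y)\<^sup>2 = (\<Sum>t<d. real_of_int (?g t))"
    unfolding eucl_dist_def L2_set_def by (simp add: sum_nonneg)
  also have "\<dots> = (\<Sum>t<3 * D. real_of_int (?g t))"
    using assms by (intro sum.mono_neutral_right) (auto simp: block_point_def)
  also have "{..<3 * D} = {0..<0 + D} \<union> {D..<D + D} \<union> {2 * D..<2 * D + D}" by auto
  also have "(\<Sum>t\<in>\<dots>. real_of_int (?g t)) = (\<Sum>t\<in>{0..<0 + D}. ?g t) + (\<Sum>t\<in>{D..<D + D}. ?g t)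
      + (\<Sum>t\<in>{2 * D..<2 * D + D}. ?g t)"
    by (subst sum.union_disjoint, simp, simp, force, subst sum.union_disjoint) auto
  also have "\<dots> = (\<Sum>t<D. ?g (t + 0)) + (\<Sum>t<D. ?g (t + D)) + (\<Sum>t<D. ?g (t + 2 * D))"
    unfolding shift ..
  also have "(\<Sum>t<D. ?g (t + 0)) = (\<Sum>t<D. (a t - a' t)\<^sup>2)"
    using assms by (intro sum.cong) (auto simp: block_point_def)
  also have "(\<Sum>t<D. ?g (t + D)) = (\<Sum>t<D. (b t - b' t)\<^sup>2)"
    using assms by (intro sum.cong) (auto simp: block_point_def)
  also have "(\<Sum>t<D. ?g (t + 2 * D)) = (\<Sum>t<D. (p t - p' t)\<^sup>2)"
    using assms by (intro sum.cong) (auto simp: block_point_def)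
  finally show ?thesis by simp
qed

text \<open>Squared distances are affine in the inner products of sign vectors, so the approximation
  factor is squared as well: (1 + \<epsilon>)^2 \<le> 1 + 3\<epsilon> for \<epsilon> \<le>
  1.\<close>

lemma valid_answer_sqD:
  assumes "valid_answer n q d \<epsilon> X Y ans" "0 \<le> \<epsilon>" "\<epsilon> \<le> 1" "j < q" "i < n"
  shows "(eucl_dist d (Y j) (X (ans j)))\<^sup>2 \<le> (1 + 3 * \<epsilon>) * (eucl_dist d (Y j) (X i))\<^sup>2"
proof -
  have nonneg: "0 \<le> eucl_dist d x y" for x y unfolding eucl_dist_def by (rule L2_set_nonneg)
  have "eucl_dist d (Y j) (X (ans j)) \<le> (1 + \<epsilon>) * (MIN i\<in>{..<n}. eucl_dist d (Y j) (X i))"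
    using assms by (auto simp: valid_answer_def)
  also have "\<dots> \<le> (1 + \<epsilon>) * eucl_dist d (Y j) (X i)"
    using assms by (intro mult_left_mono Min_le) auto
  finally have "(eucl_dist d (Y j) (X (ans j)))\<^sup>2 \<le> ((1 + \<epsilon>) * eucl_dist d (Y j) (X i))\<^sup>2"
    by (intro power_mono nonneg)
  also have "\<dots> = (1 + \<epsilon>)\<^sup>2 * (eucl_dist d (Y j) (X i))\<^sup>2" by (simp add: power_mult_distrib)
  also have "\<dots> \<le> (1 + 3 * \<epsilon>) * (eucl_dist d (Y j) (X i))\<^sup>2"
  proof (intro mult_right_mono)
    have "\<epsilon> * \<epsilon> \<le> \<epsilon> * 1" using assms by (intro mult_left_mono) auto
    then show "(1 + \<epsilon>)\<^sup>2 \<le> 1 + 3 * \<epsilon>" by (simp add: power2_eq_square algebra_simps)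
  qed auto
  finally show ?thesis .
qed

section \<open>The hard instances and their decoding\<close>

text \<open>The number \<open>h\<close> of padding coordinates left at 0 is 16\<epsilon>D up to
  rounding. This puts the decoy distance 2D - h midway between the bounds 2D - 24\<epsilon>D for
  members and 2D - 8\<epsilon>D for nonmembers.\<close>

locale sign_matrix =
  fixes n d D \<Phi> m h :: nat and \<epsilon> :: real and v :: "nat \<Rightarrow> nat set" and G :: "nat set set"
  assumes \<epsilon>: "0 < \<epsilon>" "\<epsilon> \<le> 1 / 64" and D: "1 \<le> \<epsilon> * D" "3 * D \<le> d" and \<Phi>: "2 \<le> \<Phi>"
    and h: "16 * \<epsilon> * D - 1 \<le> h" "h \<le> 16 * \<epsilon> * D"
    and sg_sg: "\<And>i l. i < n \<Longrightarrow> l < n \<Longrightarrow> i \<noteq> l \<Longrightarrow> (\<Sum>t<D. sg i (v t) * sg l (v t)) \<le> 4 * \<epsilon> * D"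
    and G_sub: "\<And>S. S \<in> G \<Longrightarrow> S \<subseteq> {..<n} \<and> card S = 2 * m + 1"
    and sg_maj_in: "\<And>S j. S \<in> G \<Longrightarrow> j \<in> S \<Longrightarrow> 12 * \<epsilon> * D \<le> (\<Sum>t<D. sg j (v t) * maj m S (v t))"
    and sg_maj_notin: "\<And>S j. S \<in> G \<Longrightarrow> j < n \<Longrightarrow> j \<notin> S \<Longrightarrow>
      (\<Sum>t<D. sg j (v t) * maj m S (v t)) \<le> 4 * \<epsilon> * D"
begin

text \<open>The even data point \<open>2 i\<close> carries the set \<open>f i\<close>; the odd data point \<open>2 i + 1\<close> has a squared
  distance of \<open>2 D - h\<close> from every query about \<open>f i\<close>, which separates members from nonmembers.\<close>

definition data :: "(nat \<Rightarrow> nat set) \<Rightarrow> nat \<Rightarrow> point" where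
  "data f = (\<lambda>a\<in>{..<n}. block_point d D (\<lambda>t. 2 * sg (a div 2) (v t))
     (\<lambda>t. if even a then maj m (f (a div 2)) (v t) else 0)
     (\<lambda>t. if odd a \<and> h \<le> t then 1 else 0))"

definition query :: "nat \<Rightarrow> nat \<Rightarrow> point" where
  "query i j = block_point d D (\<lambda>t. 2 * sg i (v t)) (\<lambda>t. sg j (v t)) (\<lambda>t. 0)"

lemma h_le_D: "h \<le> D"
proof -
  have "\<epsilon> * D \<le> 1 / 64 * D" using \<epsilon> by (intro mult_right_mono) auto
  then have "real h \<le> D" using h by linarith
  then show ?thesis by simp
qed

lemma D_pos: "0 < D" using D by (cases "D = 0") auto

text \<open>The sum equals 8D minus 8 times an inner product of at most 4\<epsilon>D. The factor 2
  in the codes pushes wrong codes well beyond the squared distances of about 2D that decide a query;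
  unscaled codes would only reach about 2D.\<close>

lemma code_dist:
  assumes "i < n" "l < n" "i \<noteq> l"
  shows "4 * real D \<le> (\<Sum>t<D. (2 * sg i (v t) - 2 * sg l (v t))\<^sup>2)"
proof -
  have "(\<Sum>t<D. (2 * sg i (v t) - 2 * sg l (v t))\<^sup>2) = (\<Sum>t<D. 8 - 8 * (sg i (v t) * sg l (v t)))"
    by (intro sum.cong) (auto simp: sg_def)
  also have "\<dots> = 8 * int D - 8 * (\<Sum>t<D. sg i (v t) * sg l (v t))"
    by (simp add: sum_subtractf sum_distrib_left)
  finally have "real_of_int (\<Sum>t<D. (2 * sg i (v t) - 2 * sg l (v t))\<^sup>2)
      = 8 * D - 8 * real_of_int (\<Sum>t<D. sg i (v t) * sg l (v t))"
    by (simp only: of_int_diff of_int_mult of_int_of_nat_eq of_int_numeral)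
  moreover have "real_of_int (\<Sum>t<D. sg i (v t) * sg l (v t)) \<le> 4 * \<epsilon> * D" by (rule sg_sg[OF assms])
  moreover have "\<epsilon> * D \<le> 1 / 64 * D" using \<epsilon> by (intro mult_right_mono) auto
  ultimately show ?thesis by linarith
qed

lemma data_in_grid: "a < n \<Longrightarrow> data f a \<in> grid d \<Phi>"
  unfolding data_def using \<Phi> by (auto intro!: block_point_in_grid simp: abs_mult)

lemma query_in_grid: "query i j \<in> grid d \<Phi>"
  unfolding query_def using \<Phi> by (auto intro!: block_point_in_grid simp: abs_mult)

lemma data_neq:
  assumes "a < n" "b < n" "a \<noteq> b"
  shows "data f a \<noteq> data f b"
proof
  assume eq: "data f a = data f b"
  have dist: "(eucl_dist d (data f a) (data f b))\<^sup>2 = 0" unfolding eq eucl_dist_def L2_set_def by simp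
  show False
  proof (cases "a div 2 = b div 2")
    case False
    have "4 * real D \<le> (\<Sum>t<D. (2 * sg (a div 2) (v t) - 2 * sg (b div 2) (v t))\<^sup>2)"
      using assms False by (intro code_dist) auto
    also have "\<dots> \<le> (eucl_dist d (data f a) (data f b))\<^sup>2"
      using assms D unfolding data_def by (simp add: eucl_dist_block_point_square sum_nonneg)
    finally show False using dist D_pos by simp
  next
    case True
    then have par: "even a \<noteq> even b" using assms(3) by (metis div_mult_mod_eq parity_cases)
    \<comment> \<open>Coordinate \<open>D\<close> opens the second block: an even point has a sign
      there, an odd one has 0.\<close>
    have "data f a D = data f b D" by (simp add: eq)
    then show False using par assms D D_pos unfolding data_def block_point_def
      by (auto simp: maj_def split: if_splits)
  qed
qed

lemma data_in_point_sets: "data f \<in> point_sets n d \<Phi>"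
proof -
  have "data f \<in> {..<n} \<rightarrow>\<^sub>E grid d \<Phi>"
    using data_in_grid by (intro PiE_I) (auto simp: data_def)
  moreover have "inj_on (data f) {..<n}" using data_neq by (auto simp: inj_on_def)
  ultimately show ?thesis by (simp add: point_sets_def)
qed

lemma query_code_dist:
  assumes "i < n" "a < n" "a div 2 \<noteq> i"
  shows "4 * real D \<le> (eucl_dist d (query i j) (data f a))\<^sup>2"
proof -
  have "4 * real D \<le> (\<Sum>t<D. (2 * sg i (v t) - 2 * sg (a div 2) (v t))\<^sup>2)"
    using assms by (intro code_dist) auto
  also have "\<dots> \<le> (eucl_dist d (query i j) (data f a))\<^sup>2"
    using assms D unfolding data_def query_def by (simp add: eucl_dist_block_point_square sum_nonneg)
  finally show ?thesis .
qed

lemma query_even_dist: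
  assumes "2 * i < n"
  shows "(eucl_dist d (query i j) (data f (2 * i)))\<^sup>2
    = 2 * D - 2 * real_of_int (\<Sum>t<D. sg j (v t) * maj m (f i) (v t))"
proof -
  have "(\<Sum>t<D. (sg j (v t) - maj m (f i) (v t))\<^sup>2) = (\<Sum>t<D. 2 - 2 * (sg j (v t) * maj m (f i) (v t)))"
    by (intro sum.cong) (auto simp: sg_def maj_def)
  also have "\<dots> = 2 * int D - 2 * (\<Sum>t<D. sg j (v t) * maj m (f i) (v t))"
    by (simp add: sum_subtractf sum_distrib_left)
  finally have *: "real_of_int (\<Sum>t<D. (sg j (v t) - maj m (f i) (v t))\<^sup>2)
      = 2 * D - 2 * real_of_int (\<Sum>t<D. sg j (v t) * maj m (f i) (v t))"
    by (simp only: of_int_diff of_int_mult of_int_of_nat_eq of_int_numeral)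
  show ?thesis
    using assms D unfolding data_def query_def
    by (simp add: eucl_dist_block_point_square del: of_int_sum) (simp only: *)
qed

lemma query_odd_dist:
  assumes "2 * i + 1 < n"
  shows "(eucl_dist d (query i j) (data f (2 * i + 1)))\<^sup>2 = 2 * real D - h"
proof -
  have "(\<Sum>t<D. (if h \<le> t then 1 else 0 :: real)) = real (card {t \<in> {..<D}. h \<le> t})"
    by (subst sum.inter_filter[symmetric]) auto
  also have "{t \<in> {..<D}. h \<le> t} = {h..<D}" by auto
  finally have *: "(\<Sum>t<D. (if h \<le> t then 1 else 0 :: real)) = real D - h" using h_le_D by simp
  have "(\<Sum>t<D. (0 - (if h \<le> t then 1 else 0 :: int))\<^sup>2) = (\<Sum>t<D. if h \<le> t then 1 else 0)"
    by (intro sum.cong) auto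
  moreover have "(\<Sum>t<D. (sg j (v t) - 0)\<^sup>2) = int D" by (simp add: power2_eq_square)
  ultimately show ?thesis
    using assms D * unfolding data_def query_def
    by (simp add: eucl_dist_block_point_square del: of_int_sum)
      (simp add: if_distrib cong: if_cong)
qed

text \<open>The approximation factor costs at most 6\<epsilon>D of the gap 8\<epsilon>D, so an
  answer must lie within 2D - 18\<epsilon>D, closer than the decoy and than any wrong code.\<close>

lemma valid_answer_member:
  assumes valid: "valid_answer n q d \<epsilon> (data f) Y ans" and Y: "0 < q" "Y 0 = query i j"
    and i: "i < n div 2" and f: "f i \<in> G" and j: "j \<in> f i"
  shows "ans 0 = 2 * i"
proof (rule ccontr)
  assume neq: "ans 0 \<noteq> 2 * i"
  have in_n: "2 * i + 1 < n" "i < n" using i by auto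
  have ans: "ans 0 < n" using valid Y by (auto simp: valid_answer_def)
  have "(eucl_dist d (query i j) (data f (ans 0)))\<^sup>2
      \<le> (1 + 3 * \<epsilon>) * (eucl_dist d (query i j) (data f (2 * i)))\<^sup>2"
    using valid_answer_sqD[OF valid, of 0 "2 * i"] Y in_n \<epsilon> by simp
  also have "\<dots> \<le> (1 + 3 * \<epsilon>) * (2 * D - 24 * (\<epsilon> * D))"
    using sg_maj_in[OF f j] \<epsilon> in_n by (intro mult_left_mono) (auto simp: query_even_dist)
  also have "\<dots> = 2 * D - 18 * (\<epsilon> * D) - 72 * (\<epsilon> * (\<epsilon> * D))" by (simp add: algebra_simps)
  also have "\<dots> \<le> 2 * D - 18 * (\<epsilon> * D)" using \<epsilon> by simp
  finally have up: "(eucl_dist d (query i j) (data f (ans 0)))\<^sup>2 \<le> 2 * D - 18 * (\<epsilon> * D)" .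
  show False
  proof (cases "ans 0 div 2 = i")
    case True
    then have "ans 0 = 2 * i + 1" using neq by auto
    then show False using up query_odd_dist[OF in_n(1), of j f] h D by simp
  next
    case False
    then show False using up query_code_dist[OF in_n(2) ans False, of j f] D by simp
  qed
qed

text \<open>Now the decoy is the near point, and after the approximation factor its bound still
  stays below the 2D - 8\<epsilon>D of the even point.\<close>

lemma valid_answer_nonmember:
  assumes valid: "valid_answer n q d \<epsilon> (data f) Y ans" and Y: "0 < q" "Y 0 = query i j"
    and i: "i < n div 2" and f: "f i \<in> G" and j: "j < n" "j \<notin> f i"
  shows "ans 0 = 2 * i + 1"
proof (rule ccontr)
  assume neq: "ans 0 \<noteq> 2 * i + 1"
  have in_n: "2 * i + 1 < n" "2 * i < n" "i < n" using i by auto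
  have ans: "ans 0 < n" using valid Y by (auto simp: valid_answer_def)
  have "(eucl_dist d (query i j) (data f (ans 0)))\<^sup>2
      \<le> (1 + 3 * \<epsilon>) * (eucl_dist d (query i j) (data f (2 * i + 1)))\<^sup>2"
    using valid_answer_sqD[OF valid, of 0 "2 * i + 1"] Y in_n \<epsilon> by simp
  also have "\<dots> \<le> (1 + 3 * \<epsilon>) * (2 * D - 16 * (\<epsilon> * D) + 1)"
    unfolding query_odd_dist[OF in_n(1)] using h \<epsilon> by (intro mult_left_mono) auto
  also have "\<dots> = 2 * D - 10 * (\<epsilon> * D) + 1 - 3 * \<epsilon> * (16 * (\<epsilon> * D) - 1)" by (simp add: algebra_simps)
  \<comment> \<open>The summand 1 comes from rounding \<open>h\<close> down; 1 \<le> \<epsilon>D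
    absorbs it.\<close>
  also have "\<dots> < 2 * D - 8 * (\<epsilon> * D)"
  proof -
    have "0 \<le> 3 * \<epsilon> * (16 * (\<epsilon> * D) - 1)" using \<epsilon> D by (intro mult_nonneg_nonneg) auto
    then show ?thesis using D by linarith
  qed
  finally have up: "(eucl_dist d (query i j) (data f (ans 0)))\<^sup>2 < 2 * D - 8 * (\<epsilon> * D)" .
  show False
  proof (cases "ans 0 div 2 = i")
    case True
    then have "ans 0 = 2 * i" using neq by auto
    then show False using up query_even_dist[OF in_n(2), of j f] sg_maj_notin[OF f j] by simp
  next
    case False
    then show False using up query_code_dist[OF in_n(3) ans False, of j f] D by simp
  qed
qed

text \<open>Bob's input must consist of \<open>q\<close> distinct points, so the query of interest,
  at index 0, is padded with data points: they supply \<open>n\<close> distinct grid points, of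
  which at least \<open>q - 1\<close> differ from the query.\<close>

lemma exists_query_set:
  assumes q: "0 < q" "q \<le> n"
  shows "\<exists>Y \<in> point_sets q d \<Phi>. Y 0 = query i j"
proof -
  \<comment> \<open>Any assignment of sets yields distinct grid points, so an arbitrary one
    serves.\<close>
  let ?D = "data undefined ` {..<n} - {query i j}"
  have "card (data undefined ` {..<n}) = n"
    using data_neq by (subst card_image) (auto simp: inj_on_def)
  then have "q - 1 \<le> card ?D" using q by (auto simp: card_Diff_singleton_if)
  then obtain T where T: "T \<subseteq> ?D" "card T = q - 1" "finite T" by (meson obtain_subset_with_card_n)
  obtain g where g: "bij_betw g {..<q - 1} T"
    using T by (metis atLeast0LessThan ex_bij_betw_nat_finite)
  define Y where "Y = (\<lambda>a\<in>{..<q}. if a = 0 then query i j else g (a - 1))"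
  have gT: "g (a - 1) \<in> T" if "0 < a" "a < q" for a
    using bij_betwE[OF g] that by auto
  have "data undefined ` {..<n} \<subseteq> grid d \<Phi>" by (intro image_subsetI data_in_grid) simp
  then have "T \<subseteq> grid d \<Phi>" using T(1) by (meson Diff_subset subset_trans)
  then have "g (a - 1) \<in> grid d \<Phi>" if "0 < a" "a < q" for a
    using gT[OF that] by (rule subsetD)
  then have "Y \<in> {..<q} \<rightarrow>\<^sub>E grid d \<Phi>"
    using query_in_grid by (auto simp: Y_def)
  moreover have "inj_on Y {..<q}"
  proof (rule inj_onI)
    fix a b assume ab: "a \<in> {..<q}" "b \<in> {..<q}" "Y a = Y b"
    have notin: "query i j \<notin> T" using T by auto
    show "a = b"
    proof (cases "a = 0 \<or> b = 0")
      case True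
      then show ?thesis using ab gT notin by (auto simp: Y_def split: if_splits) metis+
    next
      case False
      then have "a - 1 = b - 1" using ab bij_betw_imp_inj_on[OF g]
        by (auto simp: Y_def inj_on_def)
      then show ?thesis using False by arith
    qed
  qed
  ultimately show ?thesis using q by (intro bexI[of _ Y]) (auto simp: point_sets_def Y_def)
qed

text \<open>The inputs are all assignments of a set in \<open>G\<close> to each
  \<open>i < n div 2\<close>. Two of them disagree on whether some \<open>j\<close> belongs to the
  set at some \<open>i\<close>, and query (i, j) then forces answer \<open>2 * i\<close> for one and
  \<open>2 * i + 1\<close> for the other.\<close>

lemma card_pow_le_sketches:
  assumes q: "0 < q" "q \<le> n" and \<delta>: "\<delta> < 1 / (real n)\<^sup>2"
    and solves: "solves_all_nearest_neighbors n q d \<Phi> \<epsilon> \<delta> A B"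
    and size: "sketch_size_le n d \<Phi> A s"
  shows "card G ^ (n div 2) \<le> 2 ^ (s + 1)"
proof -
  let ?N = "n div 2"
  let ?F = "{..<?N} \<rightarrow>\<^sub>E G" and ?Q = "{..<?N} \<times> {..<n}"
  have "\<forall>y. \<exists>Y \<in> point_sets q d \<Phi>. Y 0 = query (fst y) (snd y)"
    using exists_query_set[OF q] by blast
  then obtain Y where "\<And>y. Y y \<in> point_sets q d \<Phi>" "\<And>y. Y y 0 = query (fst y) (snd y)"
    by metis
  then have Y: "\<And>i j. Y (i, j) \<in> point_sets q d \<Phi>" "\<And>i j. Y (i, j) 0 = query i j" by auto
  have n: "0 < n" using q by simp
  have "card ?F \<le> card {sk :: bool list. length sk \<le> s}"
  proof (rule card_le_card_sketches[where A = "\<lambda>f. A (data f)" and B = "\<lambda>sk y. B sk (Y y)" and Q = ?Q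
        and W = "\<lambda>f y. {ans. valid_answer n q d \<epsilon> (data f) (Y y) ans}" and \<delta> = \<delta>])
    \<comment> \<open>With at most n^2/2 queries the assumed error below 1/n^2 suffices. The case of
      no queries is separate because scaling by 0 would lose strictness.\<close>
    have "real (?N * n) * \<delta> < 1 / 2"
    proof (cases "?N * n = 0")
      case True
      then have "real (?N * n) = 0" by (simp only: of_nat_0)
      then have "real (?N * n) * \<delta> = 0" by (simp only: mult_zero_left)
      then show ?thesis by linarith
    next
      case False
      then have "real (?N * n) * \<delta> < real (?N * n) * (1 / (real n)\<^sup>2)"
        using \<delta> by (intro mult_strict_left_mono) auto
      also have "\<dots> = real ?N / n" using n by (simp add: power2_eq_square field_simps)
      also have "\<dots> \<le> 1 / 2" using n by (simp add: field_simps)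
      finally show ?thesis .
    qed
    then show "real (card ?Q) * \<delta> < 1 / 2" by (simp add: card_cartesian_product)
    show "1 - \<delta> \<le> measure_pmf.prob (A (data f) \<bind> (\<lambda>k. B k (Y y)))
        {ans. valid_answer n q d \<epsilon> (data f) (Y y) ans}" for f y
      using solves data_in_point_sets Y(1)[of "fst y" "snd y"]
      unfolding solves_all_nearest_neighbors_def by auto
    show "finite {sk :: bool list. length sk \<le> s}"
      using finite_lists_length_le[of "UNIV :: bool set" s] by simp
    show "set_pmf (A (data f)) \<subseteq> {sk. length sk \<le> s}" for f
      using size data_in_point_sets unfolding sketch_size_le_def by auto
  next
    fix f f' assume ff: "f \<in> ?F" "f' \<in> ?F" "f \<noteq> f'"
    then obtain i where i: "i < ?N" "f i \<noteq> f' i" by (metis PiE_ext lessThan_iff)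
    have G: "f i \<in> G" "f' i \<in> G" using ff i by auto
    have sub: "f i \<subseteq> {..<n}" "f' i \<subseteq> {..<n}" using G_sub G by auto
    obtain j where j: "j < n" "j \<in> f i \<longleftrightarrow> j \<notin> f' i" using i(2) sub by blast
    have member: "ans 0 = 2 * i" if "valid_answer n q d \<epsilon> (data f) (Y (i, j)) ans" "f i \<in> G" "j \<in> f i"
      for f ans using valid_answer_member[OF that(1) q(1) Y(2) i(1) that(2,3)] .
    have nonmember: "ans 0 = 2 * i + 1"
      if "valid_answer n q d \<epsilon> (data f) (Y (i, j)) ans" "f i \<in> G" "j \<notin> f i"
      for f ans using valid_answer_nonmember[OF that(1) q(1) Y(2) i(1) that(2) j(1) that(3)] .
    have "False" if "valid_answer n q d \<epsilon> (data f) (Y (i, j)) ans"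
      "valid_answer n q d \<epsilon> (data f') (Y (i, j)) ans" for ans
    proof (cases "j \<in> f i")
      case True
      then show False using member[OF that(1) G(1)] nonmember[OF that(2) G(2)] j(2) by simp
    next
      case False
      then show False using nonmember[OF that(1) G(1)] member[OF that(2) G(2)] j(2) by simp
    qed
    then have "{ans. valid_answer n q d \<epsilon> (data f) (Y (i, j)) ans}
        \<inter> {ans. valid_answer n q d \<epsilon> (data f') (Y (i, j)) ans} = {}" by blast
    then show "\<exists>y\<in>?Q. {ans. valid_answer n q d \<epsilon> (data f) (Y y) ans}
        \<inter> {ans. valid_answer n q d \<epsilon> (data f') (Y y) ans} = {}"
      using i j by (intro bexI[of _ "(i, j)"]) auto
  qed auto
  also have "\<dots> \<le> 2 ^ (s + 1)" by (rule card_bool_lists_le)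
  finally show ?thesis by (simp add: card_PiE)
qed

end

section \<open>From the counting bound to bits\<close>

text \<open>Logarithms of \<open>n choose k\<close> \<ge> (n/k)^k give about (n/2) * k * log (n/k)
  bits, where k is of order 1/\<epsilon>^2 and n/k is at least 2 * n^(2\<beta>). Halving the family
  and the extra sketch bit cost only constant factors.\<close>

lemma card_bound_imp_sketch_bound:
  fixes \<epsilon> \<beta> :: real and n m s g :: nat
  assumes \<epsilon>: "0 < \<epsilon>" and n: "1 / real n powr (0.5 - \<beta>) \<le> \<epsilon>" "1 < n"
    and m: "1 / (2048 * \<epsilon>\<^sup>2) \<le> m" "m \<le> 1 / (1024 * \<epsilon>\<^sup>2)" and k: "2 * m + 1 \<le> n"
    and g: "(n choose (2 * m + 1)) \<le> 2 * g" "g ^ (n div 2) \<le> 2 ^ (s + 1)"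
  shows "1 / 10000 * \<beta> * (1 / \<epsilon>\<^sup>2) * real n * log 2 (real n) \<le> real s"
proof -
  define k where "k = 2 * m + 1"
  define L where "L = log 2 (real n / real k)"
  have n0: "0 < real n" using n by simp
  have "0 < 1 / (2048 * \<epsilon>\<^sup>2)" using \<epsilon> by simp
  then have m0: "1 \<le> m" using m by (cases m) auto
  have "1 / \<epsilon> \<le> real n powr (0.5 - \<beta>)" using n n0 \<epsilon> by (simp add: field_simps)
  then have "(1 / \<epsilon>)\<^sup>2 \<le> (real n powr (0.5 - \<beta>))\<^sup>2" using \<epsilon> by (intro power_mono) auto
  also have "\<dots> = real n powr (1 - 2 * \<beta>)"
    using n0 by (simp add: power2_eq_square powr_add[symmetric])
  also have "\<dots> = real n / real n powr (2 * \<beta>)" using n0 by (simp add: powr_diff)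
  finally have n\<beta>: "real n powr (2 * \<beta>) \<le> real n * \<epsilon>\<^sup>2"
    using \<epsilon> n0 by (simp add: field_simps)
  have k1: "1 / (1024 * \<epsilon>\<^sup>2) \<le> k" using m by (simp add: k_def)
  have "real k \<le> 3 * m" using m0 by (simp add: k_def)
  then have k2: "real k \<le> 3 / (1024 * \<epsilon>\<^sup>2)" using m by simp
  have k0: "0 < real k" by (simp add: k_def)
  \<comment> \<open>The small constant in \<open>k\<close> leaves room for the factor 2, whose
    logarithm is the 1 that keeps \<open>L\<close> \<ge> 1 even for tiny \<beta>.\<close>
  have "2 * real n powr (2 * \<beta>) \<le> 2 * (real n * \<epsilon>\<^sup>2)" using n\<beta> by simp
  also have "\<dots> \<le> real n / real k"
  proof -
    have "2 * \<epsilon>\<^sup>2 * real k \<le> 2 * \<epsilon>\<^sup>2 * (3 / (1024 * \<epsilon>\<^sup>2))" using k2 by (intro mult_left_mono) auto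
    also have "\<dots> \<le> 1" using \<epsilon> by simp
    finally have "2 * \<epsilon>\<^sup>2 * real k * real n \<le> 1 * real n" by (intro mult_right_mono) auto
    then show ?thesis using k0 by (simp add: field_simps)
  qed
  finally have nk: "2 * real n powr (2 * \<beta>) \<le> real n / real k" .
  have "log 2 (2 * real n powr (2 * \<beta>)) \<le> L" unfolding L_def
    using nk n0 k0 by (subst log_le_cancel_iff) auto
  then have L: "1 + 2 * \<beta> * log 2 n \<le> L" using n0 by (simp add: log_mult log_powr)
  show ?thesis
  proof (cases "\<beta> \<le> 0")
    case True
    have "0 \<le> log 2 (real n)" using n by simp
    then have "1 / 10000 * \<beta> * (1 / \<epsilon>\<^sup>2) * real n * log 2 (real n) \<le> 0"
      using True by (simp add: mult_nonpos_nonneg divide_nonpos_nonneg)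
    then show ?thesis by linarith
  next
    case False
    have L1: "1 \<le> L"
    proof -
      have "0 \<le> 2 * \<beta> * log 2 n" using False n by simp
      then show ?thesis using L by linarith
    qed
    have "(real n / real k) ^ k \<le> real (n choose k)"
      using k by (intro binomial_ge_n_over_k_pow_k) (simp add: k_def)
    also have "\<dots> \<le> 2 * real g" using g(1) by (simp add: k_def flip: of_nat_mult)
    finally have gk: "(real n / real k) ^ k / 2 \<le> real g" by simp
    have pos: "0 < (real n / real k) ^ k / 2" using n0 k0 by simp
    then have g0: "0 < real g" using gk by linarith
    have "real (n div 2) * log 2 g = log 2 (real (g ^ (n div 2)))" using g0 by (simp add: log_nat_power)
    also have "\<dots> \<le> log 2 (real (2 ^ (s + 1)))"
      using g g0 by (subst log_le_cancel_iff) (auto simp flip: of_nat_power)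
    also have "\<dots> = real s + 1" by (simp add: log_mult log_nat_power)
    finally have s1: "real (n div 2) * log 2 g \<le> real s + 1" .
    have "log 2 ((real n / real k) ^ k / 2) \<le> log 2 g"
      using gk pos g0 by (subst log_le_cancel_iff) auto
    then have lg: "k * L - 1 \<le> log 2 g"
      unfolding L_def using n0 k0 by (simp add: log_divide log_nat_power)
    have kL: "3 \<le> k * L" using L1 m0 mult_mono[of 3 "real k" 1 L] by (simp add: k_def)
    have n3: "3 \<le> n" using k m0 by simp
    have half: "real n / 3 \<le> real (n div 2)" using n3 by linarith
    \<comment> \<open>As \<open>k * L\<close> \<ge> 3, the subtracted 1 takes at most a third of
      \<open>k * L\<close>.\<close>
    have "real n / 3 * (2 / 3 * (k * L)) \<le> real (n div 2) * log 2 g"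
      using half lg kL by (intro mult_mono) auto
    then have s2: "2 / 9 * (real n * (k * L)) \<le> real s + 1" using s1 by simp
    have "3 * 3 \<le> real n * (k * L)" using n3 kL by (intro mult_mono) auto
    then have s3: "1 / 9 * (real n * (k * L)) \<le> real s" using s2 by simp
    have "1 / (1024 * \<epsilon>\<^sup>2) * (2 * \<beta> * log 2 n) \<le> k * L"
      using k1 L False n by (intro mult_mono) auto
    then have "real n * (1 / (1024 * \<epsilon>\<^sup>2) * (2 * \<beta> * log 2 n)) \<le> real n * (k * L)"
      by (intro mult_left_mono) auto
    moreover define T where "T = \<beta> * (1 / \<epsilon>\<^sup>2) * real n * log 2 (real n)"
    ultimately have "2 / 1024 * T \<le> real n * (k * L)" by (simp add: mult_ac)
    moreover have "0 \<le> T" unfolding T_def using False n by simp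
    \<comment> \<open>The accumulated constant is 1/9 * 2/1024 = 1/4608.\<close>
    ultimately have "1 / 10000 * T \<le> real s" using s3 by linarith
    then show ?thesis by (simp add: T_def mult_ac)
  qed
qed

section \<open>Choice of parameters\<close>

theorem theorem4:
  "\<exists>\<epsilon>\<^sub>0>0::real. \<exists>C>0::real. \<exists>c>0::real.
     \<forall>\<beta>>0::real. \<forall>(n::nat) (q::nat) (d::nat) (\<Phi>::nat) (\<epsilon>::real) (\<delta>::real) (A::alice) (B::bob) (s::nat).
       1 \<le> q \<longrightarrow> q \<le> n \<longrightarrow>
       real d \<ge> C * (1 / \<epsilon>\<^sup>2) * log 2 (real n) \<longrightarrow>
       real \<Phi> \<ge> 1 / \<epsilon> \<longrightarrow>
       1 / real n powr (0.5 - \<beta>) \<le> \<epsilon> \<longrightarrow> \<epsilon> \<le> \<epsilon>\<^sub>0 \<longrightarrow>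
       \<delta> < 1 / (real n)\<^sup>2 \<longrightarrow>
       solves_all_nearest_neighbors n q d \<Phi> \<epsilon> \<delta> A B \<longrightarrow>
       sketch_size_le n d \<Phi> A s \<longrightarrow>
       real s \<ge> c * \<beta> * (1 / \<epsilon>\<^sup>2) * real n * log 2 (real n)"
proof (rule exI[of _ "1 / 64"], rule conjI, simp, rule exI[of _ 6], rule conjI, simp,
    rule exI[of _ "1 / 10000"], rule conjI, simp, intro allI impI)
  fix \<beta> \<epsilon> \<delta> :: real and n q d \<Phi> s :: nat and A :: alice and B :: bob
  assume \<beta>: "\<beta> > 0" and q: "1 \<le> q" "q \<le> n" and d: "real d \<ge> 6 * (1 / \<epsilon>\<^sup>2) * log 2 (real n)"
    and \<Phi>: "real \<Phi> \<ge> 1 / \<epsilon>" and n\<epsilon>: "1 / real n powr (0.5 - \<beta>) \<le> \<epsilon>" and \<epsilon>64: "\<epsilon> \<le> 1 / 64"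
    and \<delta>: "\<delta> < 1 / (real n)\<^sup>2" and solves: "solves_all_nearest_neighbors n q d \<Phi> \<epsilon> \<delta> A B"
    and size: "sketch_size_le n d \<Phi> A s"
  have n0: "0 < real n" using q by simp
  have "0 < 1 / real n powr (0.5 - \<beta>)" using n0 by simp
  then have \<epsilon>0: "0 < \<epsilon>" using n\<epsilon> by linarith
  have inv: "64 \<le> 1 / \<epsilon>" using \<epsilon>0 \<epsilon>64 by (simp add: field_simps)
  then have inv2: "64\<^sup>2 \<le> (1 / \<epsilon>)\<^sup>2" by (intro power_mono) auto
  have n1: "1 / \<epsilon>\<^sup>2 \<le> n"
  proof -
    have "1 \<le> real n" using q by simp
    have "1 / \<epsilon> \<le> real n powr (0.5 - \<beta>)" using n\<epsilon> n0 \<epsilon>0 by (simp add: field_simps)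
    also have "\<dots> \<le> real n powr 0.5" using \<beta> \<open>1 \<le> real n\<close> by (intro powr_mono) auto
    finally have "(1 / \<epsilon>)\<^sup>2 \<le> (real n powr 0.5)\<^sup>2" using \<epsilon>0 by (intro power_mono) auto
    also have "\<dots> = n" using n0 by (simp add: power2_eq_square powr_add[symmetric])
    finally show ?thesis by (simp add: power_divide)
  qed
  then have n4096: "4096 \<le> real n" using inv2 by (simp add: power_divide)
  \<comment> \<open>The constant 1024 makes the majority bias, at least 1 / (2 sqrt m), no smaller
    than 16\<epsilon>. Since \<epsilon> \<le> 1/64, the number rounded is at least 4, so rounding
    loses less than a factor 2.\<close>
  define m where "m = nat \<lfloor>1 / (1024 * \<epsilon>\<^sup>2)\<rfloor>"
  define z where "z = 1 / (1024 * \<epsilon>\<^sup>2)"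
  have z4: "4 \<le> z" using inv2 by (simp add: z_def power_divide)
  have m: "z / 2 \<le> m" "m \<le> z" "0 < m" using z4 unfolding m_def z_def[symmetric] by linarith+
  have "2 * real m + 1 \<le> 1024 * z" using m z4 by linarith
  also have "\<dots> \<le> n" using n1 by (simp add: z_def)
  finally have k: "2 * m + 1 \<le> n" by linarith
  have bias: "16 * \<epsilon> * 4 ^ m \<le> (2 * m choose m)"
  proof -
    have "1024 * \<epsilon>\<^sup>2 * m \<le> 1" using m(2) \<epsilon>0 by (simp add: z_def field_simps)
    have "real (16 ^ m) \<le> real (4 * m * (2 * m choose m)\<^sup>2)"
      using central_binomial_sq_ge[OF m(3)] by (simp only: of_nat_le_iff)
    then have central: "16 ^ m \<le> real (4 * m * (2 * m choose m)\<^sup>2)" by simp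
    have "(16 * \<epsilon> * 4 ^ m)\<^sup>2 = 256 * \<epsilon>\<^sup>2 * 16 ^ m"
      by (simp add: power2_eq_square mult_ac flip: power_mult_distrib)
    also have "\<dots> \<le> 256 * \<epsilon>\<^sup>2 * real (4 * m * (2 * m choose m)\<^sup>2)"
      by (rule mult_left_mono[OF central]) simp
    also have "\<dots> = 1024 * \<epsilon>\<^sup>2 * m * (real (2 * m choose m))\<^sup>2" by simp
    also have "\<dots> \<le> 1 * (real (2 * m choose m))\<^sup>2"
      using \<open>1024 * \<epsilon>\<^sup>2 * m \<le> 1\<close> by (intro mult_right_mono) auto
    finally have "(16 * \<epsilon> * 4 ^ m)\<^sup>2 \<le> (real (2 * m choose m))\<^sup>2" by (simp only: mult_1)
    then show ?thesis by (rule power2_le_imp_le) simp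
  qed
  define D where "D = d div 3"
  \<comment> \<open>The dimension constant 6 pays for the three blocks and, with a factor 2 to
    spare, for the rounding in \<open>d div 3\<close>.\<close>
  have D: "1 / \<epsilon>\<^sup>2 * ln n \<le> D"
  proof -
    have "ln n = log 2 n * ln 2" using n0 by (simp add: log_def)
    also have "\<dots> \<le> log 2 n * 1" using n4096 ln_2_less_1 by (intro mult_left_mono) auto
    finally have "1 / \<epsilon>\<^sup>2 * ln n \<le> 1 / \<epsilon>\<^sup>2 * log 2 n" using \<epsilon>0 by (intro mult_left_mono) auto
    moreover have "1 * 1 \<le> 1 / \<epsilon>\<^sup>2 * log 2 n"
    proof (intro mult_mono)
      show "1 \<le> 1 / \<epsilon>\<^sup>2" using inv2 by (simp add: power_divide)
      show "1 \<le> log 2 n" using n4096 by (subst le_log_iff) auto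
    qed auto
    ultimately show ?thesis using d unfolding D_def by linarith
  qed
  have ln1: "1 \<le> ln n"
  proof -
    have "exp 1 \<le> real n" using exp_le n4096 by linarith
    then show ?thesis using n0 by (simp add: ln_ge_iff)
  qed
  have \<epsilon>D: "1 \<le> \<epsilon> * D"
  proof -
    have "1 / \<epsilon>\<^sup>2 * 1 \<le> 1 / \<epsilon>\<^sup>2 * ln n" using ln1 by (intro mult_left_mono) auto
    then have "\<epsilon> * (1 / \<epsilon>\<^sup>2) \<le> \<epsilon> * D" using D \<epsilon>0 by (intro mult_left_mono) auto
    then show ?thesis using inv \<epsilon>0 by (simp add: power2_eq_square)
  qed
  \<comment> \<open>The choice of \<open>D\<close> makes the exponential at most n^(-4), which beats
    the n^2 + 2n events of the union bound.\<close>
  have small: "((real n)\<^sup>2 + 2 * real n) * exp (- (4 * D * \<epsilon>\<^sup>2)) < 1"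
  proof -
    have "ln n \<le> D * \<epsilon>\<^sup>2" using D \<epsilon>0 by (simp add: field_simps)
    then have "exp (- (4 * D * \<epsilon>\<^sup>2)) \<le> exp (- (real 4 * ln n))" by simp
    also have "\<dots> = 1 / real n ^ 4" unfolding exp_minus exp_of_nat_mult using n0 by (simp add: field_simps)
    finally have "((real n)\<^sup>2 + 2 * real n) * exp (- (4 * D * \<epsilon>\<^sup>2)) \<le> ((real n)\<^sup>2 + 2 * real n) * (1 / real n ^ 4)"
      using n0 by (intro mult_left_mono) auto
    also have "\<dots> < 1"
    proof -
      have "2 * real n \<le> real n * real n" using n4096 by (intro mult_right_mono) auto
      then have "(real n)\<^sup>2 + 2 * real n \<le> 2 * (real n)\<^sup>2" by (simp add: power2_eq_square)
      also have "\<dots> < (real n)\<^sup>2 * (real n)\<^sup>2"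
      proof (intro mult_strict_right_mono)
        have "2\<^sup>2 \<le> (real n)\<^sup>2" using n4096 by (intro power_mono) auto
        then show "2 < (real n)\<^sup>2" by simp
      qed (use n0 in auto)
      finally show ?thesis using n0 by (simp add: power2_eq_square power4_eq_xxxx)
    qed
    finally show ?thesis .
  qed
  have \<epsilon>2: "\<epsilon> \<le> 1 / 2" using \<epsilon>64 by simp
  obtain v G where
    vG: "\<And>i l. i < n \<Longrightarrow> l < n \<Longrightarrow> i \<noteq> l \<Longrightarrow> (\<Sum>t<D. sg i (v t) * sg l (v t)) \<le> 4 * \<epsilon> * D"
    "\<And>S. S \<in> G \<Longrightarrow> S \<subseteq> {..<n} \<and> card S = 2 * m + 1"
    "(n choose (2 * m + 1)) \<le> 2 * card G"
    "\<And>S j. S \<in> G \<Longrightarrow> j \<in> S \<Longrightarrow> 12 * \<epsilon> * D \<le> (\<Sum>t<D. sg j (v t) * maj m S (v t))"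
    "\<And>S j. S \<in> G \<Longrightarrow> j < n \<Longrightarrow> j \<notin> S \<Longrightarrow> (\<Sum>t<D. sg j (v t) * maj m S (v t)) \<le> 4 * \<epsilon> * D"
    using exists_separating_sign_matrix[OF k \<epsilon>0 \<epsilon>2 bias small] by blast
  define h where "h = nat \<lfloor>16 * \<epsilon> * D\<rfloor>"
  interpret sign_matrix n d D \<Phi> m h \<epsilon> v G
  proof
    show "2 \<le> \<Phi>" using \<Phi> inv by linarith
    show "3 * D \<le> d" by (simp add: D_def)
    show "16 * \<epsilon> * D - 1 \<le> h" "h \<le> 16 * \<epsilon> * D" using \<epsilon>D unfolding h_def by linarith+
  qed (use \<epsilon>0 \<epsilon>64 \<epsilon>D vG in auto)
  have "card G ^ (n div 2) \<le> 2 ^ (s + 1)"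
    using card_pow_le_sketches[OF _ q(2) \<delta> solves size] q by simp
  with vG(3) k m show "real s \<ge> 1 / 10000 * \<beta> * (1 / \<epsilon>\<^sup>2) * real n * log 2 (real n)"
    using \<epsilon>0 n\<epsilon> n4096
    by (intro card_bound_imp_sketch_bound[where m = m and g = "card G"]) (auto simp: z_def)
qed

end
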